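(* Let $(\Gamma,N)$ be a numbered graph with standard generating set $S$ of $\mathrm{NGP}(\Gamma,N)$. Consider the finite state automaton $\mathcal{D}$ over the alphabet $S$ whose states are the powered cliques of $(\Gamma,N)$ (all of which are accept states) together with one reject state $q_{\mathrm{rej}}$ (absorbing: every letter sends it to itself), whose start state is the empty powered clique, and whose transition map $\delta$ is: for $v\in V\Gamma$ and a powered clique $\Sigma$ with $0\le\Sigma(v)<\lfloor N(v)/2\rfloor$, $\delta(\Sigma,v)$ is the powered clique with support $(\mathrm{supp}\,\Sigma\cap\mathrm{Lk}(v))\cup\{v\}$ and powers $\delta(\Sigma,v)(u)=\Sigma(u)$ for $u\in\mathrm{Lk}(v)$, $\delta(\Sigma,v)(v)=\Sigma(v)+1$ (and $0$ elsewhere); for $v$ with $N(v)\ne2$ and $\Sigma$ with $-\lfloor N(v)/2\rfloor<\Sigma(v)\le0$, $\delta(\Sigma,v^{-1})$ is the powered clique with support $(\mathrm{supp}\,\Sigma\cap\mathrm{Lk}(v))\cup\{v\}$ and powers $\Sigma(u)$ for $u\in\mathrm{Lk}(v)$, $\Sigma(v)-1$ at $v$ (and $0$ elsewhere); in all other cases $\delta(\Sigma,v^{\pm1})=q_{\mathrm{rej}}$. Then the language accepted by $\mathcal{D}$ is exactly the set of geodesic words of $\mathrm{NGP}(\Gamma,N)$ with respect to $S$.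
   Context: A numbered graph $(\Gamma,N)$ is a finite simplicial graph $\Gamma$ with a map $N:V\Gamma\to\{2,3,\dots\}$; $\mathrm{NGP}(\Gamma,N)=\langle v\in V\Gamma\mid v^{N(v)}=1,\ uv=vu\text{ for }\{u,v\}\in E\Gamma\rangle$, with standard generating set $S=V\Gamma\cup(V\Gamma)^{-1}$ (with $v^{-1}=v$ when $N(v)=2$). A word over $S$ is geodesic if no shorter word over $S$ represents the same element. A clique is a vertex set spanning a complete subgraph; $\mathrm{Lk}(v)$ is the set of neighbours of $v$. A powered clique is a map $\Sigma:V\Gamma\to\mathbb{Z}$ whose support $\mathrm{supp}\,\Sigma=\{v\mid\Sigma(v)\ne0\}$ is a clique and with $0\le\Sigma(v)\le1$ if $N(v)=2$ and $-\lfloor N(v)/2\rfloor\le\Sigma(v)\le\lfloor N(v)/2\rfloor$ otherwise. The FSA accepts a word if processing it from the start state ends in an accept state. *)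

theory Defs
  imports "HOL-Algebra.Group"
begin

section \<open>Group presentations\<close>

datatype 'a letter = Gen 'a | Inv 'a

fun formal_inverse :: "'a letter \<Rightarrow> 'a letter" where
  "formal_inverse (Gen x) = Inv x"
| "formal_inverse (Inv x) = Gen x"

definition group_words :: "'a set \<Rightarrow> 'a letter list set" where
  "group_words X = lists (Gen ` X \<union> Inv ` X)"

text \<open>
  A relation \<open>l = r\<close> is a pair \<open>(l, r)\<close> of words. Two words represent the same element of
  \<open>\<langle>X | R\<rangle>\<close> iff they are related by the congruence on the free monoid on
  \<open>X \<union> X\<^sup>-\<^sup>1\<close> generated by free cancellation and by the relations in \<open>R\<close>.
\<close>

inductive pres_eq :: "'a set \<Rightarrow> ('a letter list \<times> 'a letter list) set
    \<Rightarrow> 'a letter list \<Rightarrow> 'a letter list \<Rightarrow> bool"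
  for X R where
  refl: "w \<in> group_words X \<Longrightarrow> pres_eq X R w w"
| sym: "pres_eq X R u w \<Longrightarrow> pres_eq X R w u"
| trans: "pres_eq X R u w \<Longrightarrow> pres_eq X R w z \<Longrightarrow> pres_eq X R u z"
| cancel: "p @ [a, formal_inverse a] @ s \<in> group_words X
    \<Longrightarrow> pres_eq X R (p @ [a, formal_inverse a] @ s) (p @ s)"
| relation: "(l, r) \<in> R \<Longrightarrow> p @ l @ s \<in> group_words X \<Longrightarrow> p @ r @ s \<in> group_words X
    \<Longrightarrow> pres_eq X R (p @ l @ s) (p @ r @ s)"

definition pres_rel :: "'a set \<Rightarrow> ('a letter list \<times> 'a letter list) set
    \<Rightarrow> ('a letter list \<times> 'a letter list) set" where
  "pres_rel X R = {(u, w). pres_eq X R u w}"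

definition presented_group :: "'a set \<Rightarrow> ('a letter list \<times> 'a letter list) set
    \<Rightarrow> 'a letter list set monoid" where
  "presented_group X R =
    \<lparr>carrier = group_words X // pres_rel X R,
     mult = (\<lambda>A B. \<Union>u\<in>A. \<Union>w\<in>B. pres_rel X R `` {u @ w}),
     one = pres_rel X R `` {[]}\<rparr>"

lemma group_words_append [simp]:
  "u @ w \<in> group_words X \<longleftrightarrow> u \<in> group_words X \<and> w \<in> group_words X"
  by (auto simp: group_words_def)

lemma group_words_Nil [simp]: "[] \<in> group_words X"
  by (simp add: group_words_def)

lemma group_words_Cons [simp]:
  "a # w \<in> group_words X \<longleftrightarrow> a \<in> Gen ` X \<union> Inv ` X \<and> w \<in> group_words X"
  by (auto simp: group_words_def)

lemma formal_inverse_formal_inverse [simp]: "formal_inverse (formal_inverse a) = a"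
  by (cases a) auto

lemma formal_inverse_letters:
  "formal_inverse a \<in> Gen ` X \<union> Inv ` X \<longleftrightarrow> a \<in> Gen ` X \<union> Inv ` X"
  by (cases a) auto

lemma group_words_inverse:
  "w \<in> group_words X \<Longrightarrow> rev (map formal_inverse w) \<in> group_words X"
  by (induction w) (simp_all add: formal_inverse_letters del: Un_iff)

lemma pres_eq_words: "pres_eq X R u w \<Longrightarrow> u \<in> group_words X \<and> w \<in> group_words X"
  by (induction rule: pres_eq.induct) auto

lemma pres_eq_context:
  "pres_eq X R u w \<Longrightarrow> p \<in> group_words X \<Longrightarrow> s \<in> group_words X
    \<Longrightarrow> pres_eq X R (p @ u @ s) (p @ w @ s)"
proof (induction rule: pres_eq.induct)
  case (refl w)
  then show ?case by (auto intro: pres_eq.refl)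
next
  case (sym u w)
  then show ?case by (auto intro: pres_eq.sym)
next
  case (trans u w z)
  then show ?case by (blast intro: pres_eq.trans)
next
  case (cancel p' a s')
  then show ?case using pres_eq.cancel[of "p @ p'" a "s' @ s" X R] by simp
next
  case (relation l r p' s')
  then show ?case using pres_eq.relation[of l r R "p @ p'" "s' @ s" X] by simp
qed

lemma pres_eq_append:
  assumes "pres_eq X R u u'" "pres_eq X R w w'"
  shows "pres_eq X R (u @ w) (u' @ w')"
  using pres_eq_context[OF assms(1), of "[]" w] pres_eq_context[OF assms(2), of u' "[]"]
    pres_eq_words[OF assms(1)] pres_eq_words[OF assms(2)]
  by (simp add: pres_eq.trans[of X R "u @ w" "u' @ w" "u' @ w'"])

lemma equiv_pres_rel: "equiv (group_words X) (pres_rel X R)"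
proof (rule equivI)
  show "pres_rel X R \<subseteq> group_words X \<times> group_words X"
    unfolding pres_rel_def by (auto dest: pres_eq_words)
  show "refl_on (group_words X) (pres_rel X R)"
    unfolding pres_rel_def by (auto simp: refl_on_def intro: pres_eq.refl)
  show "sym (pres_rel X R)"
    unfolding pres_rel_def by (auto simp: sym_def intro: pres_eq.sym)
  show "trans (pres_rel X R)"
    unfolding pres_rel_def trans_def by (blast intro: pres_eq.trans)
qed

lemma presented_group_mult:
  assumes "u \<in> group_words X" "w \<in> group_words X"
  shows "pres_rel X R `` {u} \<otimes>\<^bsub>presented_group X R\<^esub> pres_rel X R `` {w}
    = pres_rel X R `` {u @ w}"
proof -
  have "pres_rel X R `` {u' @ w'} = pres_rel X R `` {u @ w}"
    if "u' \<in> pres_rel X R `` {u}" "w' \<in> pres_rel X R `` {w}" for u' w'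
    using that pres_eq_append[of X R u u' w w']
    by (intro equiv_class_eq[OF equiv_pres_rel]) (simp add: pres_rel_def pres_eq.sym)
  moreover have "u \<in> pres_rel X R `` {u}" "w \<in> pres_rel X R `` {w}"
    using assms by (auto simp: pres_rel_def intro: pres_eq.refl)
  ultimately have "(\<Union>u'\<in>pres_rel X R `` {u}. \<Union>w'\<in>pres_rel X R `` {w}. pres_rel X R `` {u' @ w'})
      = pres_rel X R `` {u @ w}"
    by blast
  then show ?thesis
    by (simp add: presented_group_def)
qed

lemma pres_eq_left_inverse:
  "w \<in> group_words X \<Longrightarrow> pres_eq X R (rev (map formal_inverse w) @ w) []"
proof (induction w)
  case Nil
  then show ?case by (simp add: pres_eq.refl)
next
  case (Cons a w)
  have w: "w \<in> group_words X" and a: "a \<in> Gen ` X \<union> Inv ` X"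
    using Cons.prems by (simp_all del: Un_iff)
  have "pres_eq X R (rev (map formal_inverse w) @ [formal_inverse a, a] @ w)
      (rev (map formal_inverse w) @ w)"
    using pres_eq.cancel[of "rev (map formal_inverse w)" "formal_inverse a" w X R]
      group_words_inverse[OF w] w a
    by (simp add: formal_inverse_letters del: Un_iff)
  from pres_eq.trans[OF this Cons.IH[OF w]] show ?case by simp
qed

lemma group_presented_group: "group (presented_group X R)"
proof (rule groupI)
  let ?G = "presented_group X R"
  have car: "\<exists>w\<in>group_words X. A = pres_rel X R `` {w}" if "A \<in> carrier ?G" for A
    using that by (auto simp: presented_group_def quotient_def)
  have cls: "pres_rel X R `` {w} \<in> carrier ?G" if "w \<in> group_words X" for w
    using that by (auto simp: presented_group_def quotient_def)
  have one: "\<one>\<^bsub>?G\<^esub> = pres_rel X R `` {[]}"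
    by (simp add: presented_group_def)
  show "A \<otimes>\<^bsub>?G\<^esub> B \<in> carrier ?G" if "A \<in> carrier ?G" "B \<in> carrier ?G" for A B
  proof -
    obtain u w where "u \<in> group_words X" "A = pres_rel X R `` {u}"
      "w \<in> group_words X" "B = pres_rel X R `` {w}"
      using car[OF \<open>A \<in> carrier ?G\<close>] car[OF \<open>B \<in> carrier ?G\<close>] by blast
    then show ?thesis using cls[of "u @ w"] by (simp add: presented_group_mult)
  qed
  show "\<one>\<^bsub>?G\<^esub> \<in> carrier ?G"
    by (simp add: one cls)
  show "A \<otimes>\<^bsub>?G\<^esub> B \<otimes>\<^bsub>?G\<^esub> C = A \<otimes>\<^bsub>?G\<^esub> (B \<otimes>\<^bsub>?G\<^esub> C)"
    if "A \<in> carrier ?G" "B \<in> carrier ?G" "C \<in> carrier ?G" for A B C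
    using car[OF that(1)] car[OF that(2)] car[OF that(3)]
    by (auto simp: presented_group_mult)
  show "\<one>\<^bsub>?G\<^esub> \<otimes>\<^bsub>?G\<^esub> A = A" if "A \<in> carrier ?G" for A
    using car[OF that] by (auto simp: presented_group_mult one)
  show "\<exists>B\<in>carrier ?G. B \<otimes>\<^bsub>?G\<^esub> A = \<one>\<^bsub>?G\<^esub>" if "A \<in> carrier ?G" for A
  proof -
    obtain w where w: "w \<in> group_words X" "A = pres_rel X R `` {w}"
      using car[OF \<open>A \<in> carrier ?G\<close>] by blast
    let ?B = "pres_rel X R `` {rev (map formal_inverse w)}"
    have "?B \<otimes>\<^bsub>?G\<^esub> A = pres_rel X R `` {rev (map formal_inverse w) @ w}"
      using w by (simp add: presented_group_mult group_words_inverse)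
    also have "\<dots> = \<one>\<^bsub>?G\<^esub>"
      unfolding one using pres_eq_left_inverse[OF w(1), of R]
      by (intro equiv_class_eq[OF equiv_pres_rel]) (simp add: pres_rel_def)
    finally show ?thesis using cls[OF group_words_inverse[OF w(1)]] by blast
  qed
qed

definition pres_gen :: "'a set \<Rightarrow> ('a letter list \<times> 'a letter list) set \<Rightarrow> 'a
    \<Rightarrow> 'a letter list set" where
  "pres_gen X R x = pres_rel X R `` {[Gen x]}"

section \<open>Words and geodesics\<close>

fun letter_value :: "('g, 'b) monoid_scheme \<Rightarrow> ('a \<Rightarrow> 'g) \<Rightarrow> 'a letter \<Rightarrow> 'g" where
  "letter_value G g (Gen x) = g x"
| "letter_value G g (Inv x) = inv\<^bsub>G\<^esub> (g x)"

fun word_value :: "('g, 'b) monoid_scheme \<Rightarrow> ('a \<Rightarrow> 'g) \<Rightarrow> 'a letter list \<Rightarrow> 'g" where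
  "word_value G g [] = \<one>\<^bsub>G\<^esub>"
| "word_value G g (a # w) = letter_value G g a \<otimes>\<^bsub>G\<^esub> word_value G g w"

definition geodesic_words :: "('g, 'b) monoid_scheme \<Rightarrow> ('a \<Rightarrow> 'g) \<Rightarrow> 'a letter set
    \<Rightarrow> 'a letter list set" where
  "geodesic_words G g S = {w \<in> lists S.
     \<not> (\<exists>w'\<in>lists S. length w' < length w \<and> word_value G g w' = word_value G g w)}"

section \<open>Numbered graph products\<close>

definition numbered_graph :: "'a set \<Rightarrow> 'a set set \<Rightarrow> ('a \<Rightarrow> nat) \<Rightarrow> bool" where
  "numbered_graph V E N \<longleftrightarrow> finite V \<and> (\<forall>e\<in>E. e \<subseteq> V \<and> card e = 2) \<and> (\<forall>v\<in>V. N v \<ge> 2)"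

definition NGP_relations :: "'a set \<Rightarrow> 'a set set \<Rightarrow> ('a \<Rightarrow> nat)
    \<Rightarrow> ('a letter list \<times> 'a letter list) set" where
  "NGP_relations V E N =
     {(replicate (N v) (Gen v), []) | v. v \<in> V} \<union>
     {([Gen u, Gen v], [Gen v, Gen u]) | u v. {u, v} \<in> E}"

definition NGP :: "'a set \<Rightarrow> 'a set set \<Rightarrow> ('a \<Rightarrow> nat) \<Rightarrow> 'a letter list set monoid" where
  "NGP V E N = presented_group V (NGP_relations V E N)"

definition NGP_gen :: "'a set \<Rightarrow> 'a set set \<Rightarrow> ('a \<Rightarrow> nat) \<Rightarrow> 'a \<Rightarrow> 'a letter list set" where
  "NGP_gen V E N = pres_gen V (NGP_relations V E N)"

text \<open>
  The letter \<open>v\<^sup>-\<^sup>1\<close> is omitted when \<open>N v = 2\<close>, where it is identified with \<open>v\<close>.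
\<close>

definition std_gens :: "'a set \<Rightarrow> ('a \<Rightarrow> nat) \<Rightarrow> 'a letter set" where
  "std_gens V N = Gen ` V \<union> Inv ` {v \<in> V. N v \<noteq> 2}"

definition Lk :: "'a set set \<Rightarrow> 'a \<Rightarrow> 'a set" where
  "Lk E v = {u. {u, v} \<in> E}"

definition clique :: "'a set \<Rightarrow> 'a set set \<Rightarrow> 'a set \<Rightarrow> bool" where
  "clique V E C \<longleftrightarrow> C \<subseteq> V \<and> (\<forall>u\<in>C. \<forall>v\<in>C. u \<noteq> v \<longrightarrow> {u, v} \<in> E)"

definition supp :: "('a \<Rightarrow> int) \<Rightarrow> 'a set" where
  "supp \<Sigma> = {v. \<Sigma> v \<noteq> 0}"

text \<open>
  A map \<open>V \<rightarrow> \<int>\<close> is represented by its extension by \<open>0\<close> to the whole type; the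
  condition \<open>supp \<Sigma> \<subseteq> V\<close> contained in \<open>clique\<close> makes this representation unique.
\<close>

definition powered_clique :: "'a set \<Rightarrow> 'a set set \<Rightarrow> ('a \<Rightarrow> nat) \<Rightarrow> ('a \<Rightarrow> int) \<Rightarrow> bool" where
  "powered_clique V E N \<Sigma> \<longleftrightarrow> clique V E (supp \<Sigma>) \<and>
     (\<forall>v\<in>V. if N v = 2 then 0 \<le> \<Sigma> v \<and> \<Sigma> v \<le> 1
            else - int (N v div 2) \<le> \<Sigma> v \<and> \<Sigma> v \<le> int (N v div 2))"

section \<open>The automaton\<close>

record ('q, 's) fsa =
  fsa_states :: "'q set"
  fsa_alphabet :: "'s set"
  fsa_start :: 'q
  fsa_accept :: "'q set"
  fsa_delta :: "'q \<Rightarrow> 's \<Rightarrow> 'q"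

definition is_fsa :: "('q, 's) fsa \<Rightarrow> bool" where
  "is_fsa M \<longleftrightarrow> finite (fsa_states M) \<and> finite (fsa_alphabet M) \<and>
     fsa_start M \<in> fsa_states M \<and> fsa_accept M \<subseteq> fsa_states M \<and>
     (\<forall>q\<in>fsa_states M. \<forall>a\<in>fsa_alphabet M. fsa_delta M q a \<in> fsa_states M)"

definition fsa_language :: "('q, 's) fsa \<Rightarrow> 's list set" where
  "fsa_language M =
     {w \<in> lists (fsa_alphabet M). foldl (fsa_delta M) (fsa_start M) w \<in> fsa_accept M}"

datatype 'a clique_state = PClique "'a \<Rightarrow> int" | Rej

definition update_clique :: "'a set set \<Rightarrow> 'a \<Rightarrow> int \<Rightarrow> ('a \<Rightarrow> int) \<Rightarrow> ('a \<Rightarrow> int)" where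
  "update_clique E v k \<Sigma> = (\<lambda>u. if u = v then k else if u \<in> Lk E v then \<Sigma> u else 0)"

fun clique_delta :: "'a set set \<Rightarrow> ('a \<Rightarrow> nat) \<Rightarrow> 'a clique_state \<Rightarrow> 'a letter
    \<Rightarrow> 'a clique_state" where
  "clique_delta E N (PClique \<Sigma>) (Gen v) =
     (if 0 \<le> \<Sigma> v \<and> \<Sigma> v < int (N v div 2)
      then PClique (update_clique E v (\<Sigma> v + 1) \<Sigma>) else Rej)"
| "clique_delta E N (PClique \<Sigma>) (Inv v) =
     (if N v \<noteq> 2 \<and> - int (N v div 2) < \<Sigma> v \<and> \<Sigma> v \<le> 0
      then PClique (update_clique E v (\<Sigma> v - 1) \<Sigma>) else Rej)"
| "clique_delta E N Rej a = Rej"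

definition clique_fsa :: "'a set \<Rightarrow> 'a set set \<Rightarrow> ('a \<Rightarrow> nat)
    \<Rightarrow> ('a clique_state, 'a letter) fsa" where
  "clique_fsa V E N =
    \<lparr>fsa_states = PClique ` {\<Sigma>. powered_clique V E N \<Sigma>} \<union> {Rej},
     fsa_alphabet = std_gens V N,
     fsa_start = PClique (\<lambda>_. 0),
     fsa_accept = PClique ` {\<Sigma>. powered_clique V E N \<Sigma>},
     fsa_delta = clique_delta E N\<rparr>"

lemma supp_update_clique:
  "k \<noteq> 0 \<Longrightarrow> supp (update_clique E v k \<Sigma>) = supp \<Sigma> \<inter> Lk E v \<union> {v}"
  by (auto simp: supp_def update_clique_def)

lemma powered_clique_update:
  assumes "powered_clique V E N \<Sigma>" "v \<in> V" "k \<noteq> 0"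
    and "if N v = 2 then 0 \<le> k \<and> k \<le> 1 else - int (N v div 2) \<le> k \<and> k \<le> int (N v div 2)"
  shows "powered_clique V E N (update_clique E v k \<Sigma>)"
proof -
  have "clique V E (supp (update_clique E v k \<Sigma>))"
    using assms(1-3) unfolding supp_update_clique[OF assms(3)] powered_clique_def clique_def Lk_def
    by (auto simp: insert_commute)
  moreover have "if N u = 2 then 0 \<le> update_clique E v k \<Sigma> u \<and> update_clique E v k \<Sigma> u \<le> 1
      else - int (N u div 2) \<le> update_clique E v k \<Sigma> u \<and>
        update_clique E v k \<Sigma> u \<le> int (N u div 2)" if "u \<in> V" for u
    using assms that by (auto simp: update_clique_def powered_clique_def)
  ultimately show ?thesis by (simp add: powered_clique_def)
qed

lemma finite_powered_cliques:
  assumes "finite V"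
  shows "finite {\<Sigma>. powered_clique V E N \<Sigma>}"
proof (rule finite_subset)
  let ?b = "\<Sum>v\<in>V. int (N v)"
  show "{\<Sigma>. powered_clique V E N \<Sigma>} \<subseteq>
      {f. \<forall>v. (v \<in> V \<longrightarrow> f v \<in> {- ?b..?b}) \<and> (v \<notin> V \<longrightarrow> f v = 0)}"
  proof (clarify, intro conjI impI)
    fix \<Sigma> v assume S: "powered_clique V E N \<Sigma>"
    show "\<Sigma> v = 0" if "v \<notin> V"
      using S that by (auto simp: powered_clique_def clique_def supp_def)
    show "\<Sigma> v \<in> {- ?b..?b}" if "v \<in> V"
    proof -
      have "int (N v) \<le> ?b"
        using assms that by (intro member_le_sum) auto
      moreover have "- int (N v) \<le> \<Sigma> v \<and> \<Sigma> v \<le> int (N v)"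
        using S that unfolding powered_clique_def by (fastforce split: if_splits)
      ultimately show ?thesis by auto
    qed
  qed
  show "finite {f. \<forall>v. (v \<in> V \<longrightarrow> f v \<in> {- ?b..?b}) \<and> (v \<notin> V \<longrightarrow> f v = (0::int))}"
    using assms by (intro finite_set_of_finite_funs) auto
qed

lemma is_fsa_clique_fsa:
  assumes "numbered_graph V E N"
  shows "is_fsa (clique_fsa V E N)"
proof -
  have fin: "finite V" and N: "\<And>v. v \<in> V \<Longrightarrow> N v \<ge> 2"
    using assms by (auto simp: numbered_graph_def)
  have "clique_delta E N q a \<in> fsa_states (clique_fsa V E N)"
    if "q \<in> fsa_states (clique_fsa V E N)" "a \<in> std_gens V N" for q a
  proof (cases q)
    case (PClique \<Sigma>)
    then have S: "powered_clique V E N \<Sigma>" using that by (auto simp: clique_fsa_def)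
    show ?thesis
    proof (cases a)
      case (Gen v)
      then have "v \<in> V" using that by (auto simp: std_gens_def)
      then show ?thesis using PClique Gen S
        by (auto simp: clique_fsa_def intro!: imageI powered_clique_update)
    next
      case (Inv v)
      then have "v \<in> V" using that by (auto simp: std_gens_def)
      then show ?thesis using PClique Inv S
        by (auto simp: clique_fsa_def intro!: imageI powered_clique_update)
    qed
  qed (auto simp: clique_fsa_def)
  moreover have "powered_clique V E N (\<lambda>_. 0)"
    by (auto simp: powered_clique_def clique_def supp_def)
  ultimately show ?thesis
    using fin finite_powered_cliques[OF fin, of E N]
    by (auto simp: is_fsa_def clique_fsa_def std_gens_def)
qed

end

theory Submission
  imports Defs "HOL-Number_Theory.Cong"
begin

text \<open>
  A word rejected by the automaton is shortened by moving the whole \<open>v\<close>-syllable recorded in the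
  current state to the end and merging it there with the rejected letter.

  For the converse, attach to every letter \<open>v\<^sup>\<plusminus>\<^sup>1\<close> of a word, read after the prefix \<open>p\<close>,
  the hyperplane consisting of \<open>v\<close> and of the coset of \<open>\<langle>star v\<rangle>\<close> represented by \<open>p\<close>. The signed
  number of crossings of a hyperplane of type \<open>v\<close>, taken modulo \<open>N v\<close>, is invariant under the
  defining relations, hence depends only on the group element. The state \<open>\<Sigma>\<close> reached by an
  accepted word records the signed crossing numbers of the hyperplanes adjacent to its endpoint;
  therefore an accepted word crosses each hyperplane at most \<open>N v div 2\<close> times and always in the
  same direction, which is the minimum that the residue class allows.
\<close>

section \<open>Letters, exponent sums and residues of least absolute value\<close>

lemma group_words_mono: "X \<subseteq> Y \<Longrightarrow> group_words X \<subseteq> group_words Y"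
  unfolding group_words_def by (intro lists_mono) auto

fun letter_base :: "'a letter \<Rightarrow> 'a" where
  "letter_base (Gen x) = x"
| "letter_base (Inv x) = x"

lemma letter_base_map_letter [simp]: "letter_base (map_letter f a) = f (letter_base a)"
  by (cases a) auto

lemma letter_base_formal_inverse [simp]: "letter_base (formal_inverse a) = letter_base a"
  by (cases a) auto

lemma letter_base_in: "a \<in> Gen ` X \<union> Inv ` X \<longleftrightarrow> letter_base a \<in> X"
  by (cases a) auto

lemma group_words_iff: "w \<in> group_words X \<longleftrightarrow> letter_base ` set w \<subseteq> X"
  by (induction w) (auto simp: letter_base_in simp del: Un_iff)

text \<open>The exponent sum of \<open>h\<close>. It is applied to words whose letters are signed
  hyperplanes, where it is the net number of crossings of \<open>h\<close>.\<close>

definition charge :: "'h letter list \<Rightarrow> 'h \<Rightarrow> int" where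
  "charge xs h = int (count_list xs (Gen h)) - int (count_list xs (Inv h))"

lemma charge_Nil [simp]: "charge [] h = 0"
  by (simp add: charge_def)

lemma charge_append [simp]: "charge (xs @ ys) h = charge xs h + charge ys h"
  by (simp add: charge_def)

lemma charge_Cons: "charge (a # xs) h = charge [a] h + charge xs h"
  using charge_append[of "[a]" xs h] by simp

lemma charge_formal_inverse: "charge [formal_inverse a] h = - charge [a] h"
  by (cases a) (auto simp: charge_def)

lemma charge_replicate: "charge (replicate n a) h = int n * charge [a] h"
  by (induction n) (simp_all add: charge_Cons[of a "replicate _ a"] algebra_simps)

lemma charge_zero: "h \<notin> letter_base ` set xs \<Longrightarrow> charge xs h = 0"
proof -
  assume "h \<notin> letter_base ` set xs"
  then have "Gen h \<notin> set xs" "Inv h \<notin> set xs" by (metis image_eqI letter_base.simps)+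
  then show ?thesis by (simp add: charge_def)
qed

lemma count_list_letter_base:
  "count_list (map letter_base xs) h = count_list xs (Gen h) + count_list xs (Inv h)"
proof (induction xs)
  case (Cons a xs)
  then show ?case by (cases a) auto
qed simp

lemma abs_charge_le_count: "\<bar>charge xs h\<bar> \<le> int (count_list (map letter_base xs) h)"
  by (simp add: charge_def count_list_letter_base)

text \<open>If \<bar>b\<bar> < \<bar>a\<bar>, then \<bar>a - b\<bar> < 2 * \<bar>a\<bar> \<le> n, so
  a - b is a multiple of n smaller than n, hence 0. For even n the two extreme residues n/2 and -n/2
  tie, which is why only \<le> is claimed.\<close>

lemma cong_abs_minimal:
  fixes a b :: int
  assumes "[a = b] (mod int n)" "\<bar>a\<bar> \<le> int (n div 2)"
  shows "\<bar>a\<bar> \<le> \<bar>b\<bar>"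
proof (rule ccontr)
  assume "\<not> \<bar>a\<bar> \<le> \<bar>b\<bar>"
  moreover have "int n dvd a - b" using assms(1) by (simp add: cong_iff_dvd_diff)
  moreover have "2 * int (n div 2) \<le> int n" by simp
  moreover from calculation have "\<bar>a - b\<bar> < int n" using assms(2) by linarith
  ultimately show False using zdvd_imp_le[of "int n" "\<bar>a - b\<bar>"] by auto
qed

section \<open>Equality in the graph product as a congruence on words\<close>

locale numbered =
  fixes V :: "'a set" and E :: "'a set set" and N :: "'a \<Rightarrow> nat"
  assumes numbered: "numbered_graph V E N"
begin

abbreviation eqv (infix \<open>\<approx>\<close> 50) where
  "u \<approx> w \<equiv> pres_eq V (NGP_relations V E N) u w"

abbreviation W where "W \<equiv> group_words V"

abbreviation S where "S \<equiv> std_gens V N"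

declare pres_eq.trans [trans]

lemma edge_in: "{u, v} \<in> E \<Longrightarrow> u \<in> V \<and> v \<in> V \<and> u \<noteq> v"
  using numbered unfolding numbered_graph_def by fastforce

lemma Lk_sym: "u \<in> Lk E v \<longleftrightarrow> v \<in> Lk E u"
  by (simp add: Lk_def insert_commute)

lemma N_ge_2: "v \<in> V \<Longrightarrow> 2 \<le> N v"
  using numbered by (simp add: numbered_graph_def)

lemma std_gens_words: "w \<in> lists S \<Longrightarrow> w \<in> W"
  unfolding group_words_def std_gens_def by (auto simp: in_lists_conv_set)

lemma std_gens_base: "a \<in> S \<Longrightarrow> letter_base a \<in> V"
  by (auto simp: std_gens_def)

text \<open>Reduces values in the abstract group to classes of words. The only delicate letter is
  \<open>Inv x\<close>: its class is a left inverse of the generator, and in a group this determines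
  the inverse.\<close>

lemma word_value_NGP:
  "w \<in> W \<Longrightarrow> word_value (NGP V E N) (NGP_gen V E N) w = pres_rel V (NGP_relations V E N) `` {w}"
proof (induction w)
  case Nil
  show ?case by (simp add: NGP_def presented_group_def)
next
  case (Cons a w)
  let ?R = "NGP_relations V E N" and ?G = "NGP V E N"
  interpret G: group ?G unfolding NGP_def by (rule group_presented_group)
  have car: "pres_rel V ?R `` {u} \<in> carrier ?G" if "u \<in> W" for u
    using that by (auto simp: NGP_def presented_group_def quotient_def)
  have a: "[a] \<in> W" and w: "w \<in> W" using Cons.prems by (simp_all del: Un_iff)
  have "letter_value ?G (NGP_gen V E N) a = pres_rel V ?R `` {[a]}"
  proof (cases a)
    case (Gen x)
    then show ?thesis by (simp add: NGP_gen_def pres_gen_def)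
  next
    case (Inv x)
    have W: "[Inv x] \<in> W" "[Gen x] \<in> W" using a Inv by auto
    have "pres_rel V ?R `` {[Inv x]} \<otimes>\<^bsub>?G\<^esub> pres_rel V ?R `` {[Gen x]}
        = pres_rel V ?R `` {[Inv x, Gen x]}"
      using presented_group_mult[OF W, of ?R] by (simp add: NGP_def)
    also have "\<dots> = \<one>\<^bsub>?G\<^esub>"
      using pres_eq_left_inverse[OF W(2), of ?R]
      by (simp add: NGP_def presented_group_def)
        (intro equiv_class_eq[OF equiv_pres_rel], simp add: pres_rel_def)
    finally show ?thesis
      using G.inv_equality car W Inv by (simp add: NGP_gen_def pres_gen_def)
  qed
  then show ?case
    using Cons.IH[OF w] presented_group_mult[OF a w, of ?R] by (simp add: NGP_def)
qed

lemma word_value_eq_iff: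
  assumes "u \<in> W" "w \<in> W"
  shows "word_value (NGP V E N) (NGP_gen V E N) u = word_value (NGP V E N) (NGP_gen V E N) w
    \<longleftrightarrow> u \<approx> w"
  using assms
  by (simp add: word_value_NGP eq_equiv_class_iff[OF equiv_pres_rel]) (simp add: pres_rel_def)

lemma geodesic_iff:
  "w \<in> geodesic_words (NGP V E N) (NGP_gen V E N) S \<longleftrightarrow>
    w \<in> lists S \<and> \<not> (\<exists>w'\<in>lists S. length w' < length w \<and> w' \<approx> w)"
  unfolding geodesic_words_def using word_value_eq_iff std_gens_words by blast

lemma eqv_inverse_right: "w \<in> W \<Longrightarrow> w @ rev (map formal_inverse w) \<approx> []"
  using pres_eq_left_inverse[OF group_words_inverse, of w V "NGP_relations V E N"]
  by (simp add: rev_map comp_def)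

lemma eqv_append_left: "u \<approx> w \<Longrightarrow> p \<in> W \<Longrightarrow> p @ u \<approx> p @ w"
  by (rule pres_eq_append[OF pres_eq.refl])

lemma eqv_append_right: "u \<approx> w \<Longrightarrow> s \<in> W \<Longrightarrow> u @ s \<approx> w @ s"
  by (rule pres_eq_append[OF _ pres_eq.refl])

section \<open>Rejected words are not geodesic\<close>

lemma eqv_replicate_N: "v \<in> V \<Longrightarrow> replicate (N v) (Gen v) \<approx> []"
  using pres_eq.relation[of "replicate (N v) (Gen v)" "[]" "NGP_relations V E N" "[]" "[]" V]
  by (auto simp: NGP_relations_def group_words_iff)

lemma eqv_replicate_inverse:
  assumes "letter_base a \<in> V"
  shows "replicate n a @ replicate n (formal_inverse a) \<approx> []"
proof -
  have "replicate n a \<in> W" using assms by (auto simp: group_words_iff)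
  from eqv_inverse_right[OF this] show ?thesis by simp
qed

text \<open>Insert v^m v^-m after v^n; the first n + m letters are then the power relator. This
  shortens a power of \<open>v\<close> as soon as n exceeds half of \<open>N v\<close>.\<close>

lemma eqv_replicate_complement:
  assumes "v \<in> V" "n + m = N v"
  shows "replicate n (Gen v) \<approx> replicate m (Inv v)"
proof -
  have W: "replicate k (Gen v) \<in> W" "replicate k (Inv v) \<in> W" for k
    using assms by (auto simp: group_words_iff)
  have "replicate n (Gen v) \<approx> replicate n (Gen v) @ replicate m (Gen v) @ replicate m (Inv v)"
    using eqv_append_left[OF pres_eq.sym[OF eqv_replicate_inverse[of "Gen v" m]] W(1)[of n]] assms(1)
    by simp
  also have "replicate n (Gen v) @ replicate m (Gen v) @ replicate m (Inv v)
      = replicate (N v) (Gen v) @ replicate m (Inv v)"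
    unfolding assms(2)[symmetric] by (simp add: replicate_add)
  also have "\<dots> \<approx> replicate m (Inv v)"
    using eqv_append_right[OF eqv_replicate_N[OF assms(1)] W(2)[of m]] by simp
  finally show ?thesis .
qed

text \<open>Multiply ab = ba by a^-1 on both sides. The presentation commutes only positive
  generators, and this extends it to inverse letters.\<close>

lemma eqv_commute_inverse:
  assumes "[a, b] \<approx> [b, a]"
  shows "[formal_inverse a, b] \<approx> [b, formal_inverse a]"
proof -
  have "[a, b] \<in> W" using pres_eq_words[OF assms] by simp
  then have W: "[b] \<in> W" "[formal_inverse a] \<in> W" "[a] \<in> W"
    by (auto simp: group_words_iff)
  have "[formal_inverse a, b] \<approx> [formal_inverse a, b] @ [a, formal_inverse a]"
    using eqv_append_left[OF pres_eq.sym[OF eqv_inverse_right[OF W(3)]],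
        of "[formal_inverse a, b]"] W by (simp add: group_words_iff)
  also have "\<dots> = [formal_inverse a] @ [b, a] @ [formal_inverse a]" by simp
  also have "\<dots> \<approx> [formal_inverse a] @ [a, b] @ [formal_inverse a]"
    by (rule pres_eq_context[OF pres_eq.sym[OF assms] W(2) W(2)])
  also have "\<dots> = [formal_inverse a, a] @ [b, formal_inverse a]" by simp
  also have "\<dots> \<approx> [] @ [b, formal_inverse a]"
    using pres_eq_left_inverse[OF W(3), of "NGP_relations V E N"] W
    by (intro eqv_append_right) (simp_all add: group_words_iff)
  finally show ?thesis by simp
qed

lemma eqv_commute_letters:
  assumes "{letter_base a, letter_base b} \<in> E"
  shows "[a, b] \<approx> [b, a]"
proof -
  have gen: "[Gen u, Gen v] \<approx> [Gen v, Gen u]" if "{u, v} \<in> E" for u v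
    using pres_eq.relation[of "[Gen u, Gen v]" "[Gen v, Gen u]" "NGP_relations V E N" "[]" "[]" V]
      edge_in[OF that] that by (auto simp: NGP_relations_def)
  have mixed: "[Inv u, Gen v] \<approx> [Gen v, Inv u]" if "{u, v} \<in> E" for u v
    using eqv_commute_inverse[OF gen[OF that]] by simp
  have inv: "[Inv u, Inv v] \<approx> [Inv v, Inv u]" if "{u, v} \<in> E" for u v
    using eqv_commute_inverse[OF pres_eq.sym[OF mixed[OF that]]] by (simp add: pres_eq.sym)
  show ?thesis
    using assms by (cases a; cases b) (auto simp: insert_commute intro: gen mixed inv pres_eq.sym[OF mixed])
qed

lemma eqv_commute_replicate:
  assumes "{letter_base a, letter_base b} \<in> E"
  shows "replicate n a @ [b] \<approx> [b] @ replicate n a"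
proof (induction n)
  case 0
  show ?case using edge_in[OF assms] by (auto intro!: pres_eq.refl simp: group_words_iff)
next
  case (Suc n)
  have W: "[a] \<in> W" "replicate n a \<in> W"
    using edge_in[OF assms] by (auto simp: group_words_iff)
  have "replicate (Suc n) a @ [b] = [a] @ replicate n a @ [b]" by simp
  also have "\<dots> \<approx> [a] @ [b] @ replicate n a" by (rule eqv_append_left[OF Suc W(1)])
  also have "\<dots> = [a, b] @ replicate n a" by simp
  also have "\<dots> \<approx> [b, a] @ replicate n a"
    by (rule eqv_append_right[OF eqv_commute_letters[OF assms] W(2)])
  finally show ?case by simp
qed

section \<open>Syllables recorded by the states of the automaton\<close>

definition syllable :: "'a \<Rightarrow> int \<Rightarrow> 'a letter list" where
  "syllable v k = (if 0 \<le> k then replicate (nat k) (Gen v) else replicate (nat (- k)) (Inv v))"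

lemma syllable_commute: "{u, letter_base b} \<in> E \<Longrightarrow> syllable u k @ [b] \<approx> [b] @ syllable u k"
  by (simp add: syllable_def eqv_commute_replicate del: append.simps)

lemma syllable_snoc_Gen: "0 \<le> k \<Longrightarrow> syllable v k @ [Gen v] = syllable v (k + 1)"
  by (simp add: syllable_def nat_add_distrib replicate_append_same)

lemma syllable_snoc_Inv: "k \<le> 0 \<Longrightarrow> syllable v k @ [Inv v] = syllable v (k - 1)"
proof -
  assume "k \<le> 0"
  then have "nat (1 - k) = Suc (nat (- k))" by simp
  with \<open>k \<le> 0\<close> show ?thesis by (auto simp: syllable_def replicate_append_same)
qed

lemma replicate_cancel_last:
  assumes "letter_base a \<in> V" "0 < n"
  shows "replicate n a @ [formal_inverse a] \<approx> replicate (n - 1) a"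
proof -
  have "replicate n a @ [formal_inverse a] = replicate (n - 1) a @ [a, formal_inverse a]"
    using assms(2) by (cases n) (simp_all add: replicate_append_same[symmetric])
  moreover have "[a] \<in> W" "replicate (n - 1) a \<in> W"
    using assms(1) by (auto simp: group_words_iff)
  ultimately show ?thesis
    using eqv_append_left[OF eqv_inverse_right[of "[a]"], of "replicate (n - 1) a"] by simp
qed

text \<open>Runs stay inside the state set because the automaton is well formed, and the only states
  of the form \<open>PClique\<close> are the powered cliques.\<close>

lemma accepted_powered_clique:
  assumes "w \<in> lists S" "foldl (clique_delta E N) (PClique (\<lambda>_. 0)) w = PClique \<Sigma>"
  shows "powered_clique V E N \<Sigma>"
proof -
  have fsa: "is_fsa (clique_fsa V E N)" by (rule is_fsa_clique_fsa[OF numbered])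
  have "foldl (clique_delta E N) (PClique (\<lambda>_. 0)) w \<in> fsa_states (clique_fsa V E N)"
    using assms(1)
  proof (induction w rule: rev_induct)
    case Nil
    then show ?case using fsa by (simp add: is_fsa_def clique_fsa_def)
  next
    case (snoc a w)
    let ?q = "foldl (clique_delta E N) (PClique (\<lambda>_. 0)) w"
    have "?q \<in> fsa_states (clique_fsa V E N)" "a \<in> S" using snoc by simp_all
    then have "clique_delta E N ?q a \<in> fsa_states (clique_fsa V E N)"
      using fsa unfolding is_fsa_def by (metis clique_fsa_def fsa.select_convs(2,5))
    then show ?case by simp
  qed
  then show ?thesis using assms(2) by (auto simp: clique_fsa_def)
qed

text \<open>Puts the two kinds of non-rejecting transition into one form, so that later inductions
  handle \<open>v\<close> and its inverse together. In both, the power at \<open>v\<close> moves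
  away from 0.\<close>

lemma clique_delta_PClique:
  assumes "clique_delta E N (PClique \<Sigma>) a = PClique \<Sigma>'"
  obtains v k where "v = letter_base a" "\<Sigma>' = update_clique E v k \<Sigma>"
    "a = Gen v \<and> k = \<Sigma> v + 1 \<and> 0 \<le> \<Sigma> v \<and> \<Sigma> v < int (N v div 2) \<or>
     a = Inv v \<and> k = \<Sigma> v - 1 \<and> \<Sigma> v \<le> 0 \<and> - int (N v div 2) < \<Sigma> v"
  using assms by (cases a) (auto split: if_splits)

lemma foldl_snoc_PClique:
  assumes "foldl (clique_delta E N) q (w @ [a]) = PClique \<Sigma>'"
  obtains \<Sigma> where "foldl (clique_delta E N) q w = PClique \<Sigma>"
    "clique_delta E N (PClique \<Sigma>) a = PClique \<Sigma>'"
  using assms by (cases "foldl (clique_delta E N) q w") auto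

text \<open>The power recorded at \<open>u\<close> counts letters of the word that can be shuffled
  to its end. The exact length count ensures that shortening the syllable shortens the whole
  word.\<close>

lemma accepted_split_syllable:
  assumes "w \<in> lists S" "foldl (clique_delta E N) (PClique (\<lambda>_. 0)) w = PClique \<Sigma>" "u \<in> V"
  shows "\<exists>w'\<in>lists S. w \<approx> w' @ syllable u (\<Sigma> u) \<and>
    length w' + nat \<bar>\<Sigma> u\<bar> = length w"
  using assms(1,2)
proof (induction w arbitrary: \<Sigma> rule: rev_induct)
  case Nil
  then show ?case by (auto simp: syllable_def intro!: pres_eq.refl)
next
  case (snoc a w)
  have w: "w \<in> lists S" and a: "a \<in> S" using snoc.prems by auto
  have aW: "[a] \<in> W" using a by (intro std_gens_words) simp
  obtain \<Sigma>0 where \<Sigma>0: "foldl (clique_delta E N) (PClique (\<lambda>_. 0)) w = PClique \<Sigma>0"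
    "clique_delta E N (PClique \<Sigma>0) a = PClique \<Sigma>"
    using foldl_snoc_PClique[OF snoc.prems(2)] .
  obtain v k where v: "v = letter_base a" "\<Sigma> = update_clique E v k \<Sigma>0"
    "a = Gen v \<and> k = \<Sigma>0 v + 1 \<and> 0 \<le> \<Sigma>0 v \<and> \<Sigma>0 v < int (N v div 2) \<or>
     a = Inv v \<and> k = \<Sigma>0 v - 1 \<and> \<Sigma>0 v \<le> 0 \<and> - int (N v div 2) < \<Sigma>0 v"
    using clique_delta_PClique[OF \<Sigma>0(2)] .
  obtain w' where w': "w' \<in> lists S" "w \<approx> w' @ syllable u (\<Sigma>0 u)"
    "length w' + nat \<bar>\<Sigma>0 u\<bar> = length w"
    using snoc.IH[OF w \<Sigma>0(1)] by blast
  have w'W: "w' \<in> W" using w'(1) by (rule std_gens_words)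
  have step: "w @ [a] \<approx> w' @ (syllable u (\<Sigma>0 u) @ [a])"
    using eqv_append_right[OF w'(2) aW] by simp
  \<comment> \<open>The new letter extends the \<open>u\<close>-syllable, commutes past it, or
    blocks it. In the last case the transition resets the power at \<open>u\<close> to 0 and the
    syllable is empty.\<close>
  consider "u = v" | "u \<noteq> v" "u \<in> Lk E v" | "u \<noteq> v" "u \<notin> Lk E v" by blast
  then show ?case
  proof cases
    case 1
    then have "syllable u (\<Sigma>0 u) @ [a] = syllable u (\<Sigma> u)" and "nat \<bar>\<Sigma> u\<bar> = Suc (nat \<bar>\<Sigma>0 u\<bar>)"
      using v(2,3) by (auto simp: syllable_snoc_Gen syllable_snoc_Inv update_clique_def)
    then show ?thesis using step w'(1,3) by (intro bexI[of _ w']) auto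
  next
    case 2
    have \<Sigma>u: "\<Sigma> u = \<Sigma>0 u" using 2 v(2) by (simp add: update_clique_def)
    have "w' @ (syllable u (\<Sigma>0 u) @ [a]) \<approx> w' @ ([a] @ syllable u (\<Sigma>0 u))"
      using 2 v(1) by (intro eqv_append_left[OF syllable_commute w'W]) (simp add: Lk_def)
    from pres_eq.trans[OF step this] show ?thesis
      using \<Sigma>u w' a by (intro bexI[of _ "w' @ [a]"]) auto
  next
    case 3
    then have "\<Sigma> u = 0" using v(2) by (simp add: update_clique_def)
    then show ?thesis
      using snoc.prems(1) std_gens_words[OF snoc.prems(1)]
      by (intro bexI[of _ "w @ [a]"]) (simp_all add: syllable_def pres_eq.refl del: group_words_Cons)
  qed
qed

text \<open>A letter is rejected either because it cancels against the recorded syllable or because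
  it pushes the exponent past half of \<open>N v\<close>; in the latter case the complementary power
  is shorter.\<close>

lemma reject_step_shortens:
  assumes \<Sigma>: "powered_clique V E N \<Sigma>" and a: "a \<in> S"
    and rej: "clique_delta E N (PClique \<Sigma>) a = Rej"
  shows "\<exists>s\<in>lists S. s \<approx> syllable (letter_base a) (\<Sigma> (letter_base a)) @ [a] \<and>
    length s < Suc (nat \<bar>\<Sigma> (letter_base a)\<bar>)"
proof -
  define v where "v = letter_base a"
  have v: "v \<in> V" using a by (simp add: v_def std_gens_base)
  define h where "h = N v div 2"
  \<comment> \<open>The first inequality is the gain from wrapping around: h + 1 equal letters are
    replaced by N v - (h + 1) opposite ones.\<close>
  have h: "N v - (h + 1) < h + 1" "h + 1 \<le> N v" "1 \<le> h" "N v = 2 \<Longrightarrow> h = 1"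
    using N_ge_2[OF v] unfolding h_def by auto
  have \<Sigma>v: "if N v = 2 then 0 \<le> \<Sigma> v \<and> \<Sigma> v \<le> 1 else - int h \<le> \<Sigma> v \<and> \<Sigma> v \<le> int h"
    using \<Sigma> v unfolding powered_clique_def h_def by blast
  have S: "Gen v \<in> S" "N v \<noteq> 2 \<Longrightarrow> Inv v \<in> S"
    using v by (auto simp: std_gens_def)
  \<comment> \<open>For \<open>N v = 2\<close> powers are never negative, so
    \<open>cancel_neg\<close> may assume that \<open>Inv v\<close> is a letter of the
    alphabet.\<close>
  consider (cancel_neg) "a = Gen v" "\<Sigma> v < 0" "N v \<noteq> 2"
    | (wrap_pos) "a = Gen v" "\<Sigma> v = int h"
    | (cancel_pos) "a = Inv v" "0 < \<Sigma> v"
    | (wrap_neg) "a = Inv v" "\<Sigma> v = - int h"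
    using rej \<Sigma>v h(3,4) a unfolding v_def h_def
    by (cases a) (auto simp: std_gens_def split: if_splits)
  then have "\<exists>s\<in>lists S. s \<approx> syllable v (\<Sigma> v) @ [a] \<and> length s < Suc (nat \<bar>\<Sigma> v\<bar>)"
  proof cases
    case cancel_neg
    then show ?thesis
      using replicate_cancel_last[of "Inv v" "nat (- \<Sigma> v)"] v S(2)
      by (intro bexI[of _ "replicate (nat (- \<Sigma> v) - 1) (Inv v)"])
        (auto simp: syllable_def intro: pres_eq.sym)
  next
    case wrap_pos
    let ?m = "N v - (h + 1)"
    have "syllable v (\<Sigma> v) @ [a] = replicate (h + 1) (Gen v)"
      using wrap_pos by (simp add: syllable_def replicate_append_same)
    moreover have "replicate (h + 1) (Gen v) \<approx> replicate ?m (Inv v)"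
      using eqv_replicate_complement[OF v, of "h + 1" ?m] h by simp
    \<comment> \<open>If \<open>N v = 2\<close>, then \<open>Inv v\<close> is not in the alphabet,
      but \<open>?m\<close> is 0 and the word is empty.\<close>
    moreover have "replicate ?m (Inv v) \<in> lists S"
      using S h by (cases "N v = 2") auto
    ultimately show ?thesis
      using h wrap_pos by (intro bexI[of _ "replicate ?m (Inv v)"]) (auto intro: pres_eq.sym)
  next
    case cancel_pos
    then show ?thesis
      using replicate_cancel_last[of "Gen v" "nat (\<Sigma> v)"] v S(1)
      by (intro bexI[of _ "replicate (nat (\<Sigma> v) - 1) (Gen v)"])
        (auto simp: syllable_def intro: pres_eq.sym)
  next
    case wrap_neg
    let ?m = "N v - (h + 1)"
    have "syllable v (\<Sigma> v) @ [a] = replicate (h + 1) (Inv v)"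
      using wrap_neg h by (simp add: syllable_def replicate_append_same)
    moreover have "replicate ?m (Gen v) \<approx> replicate (h + 1) (Inv v)"
      using eqv_replicate_complement[OF v, of ?m "h + 1"] h by simp
    moreover have "replicate ?m (Gen v) \<in> lists S"
      using S by auto
    ultimately show ?thesis
      using h wrap_neg by (intro bexI[of _ "replicate ?m (Gen v)"]) auto
  qed
  then show ?thesis by (simp add: v_def)
qed

text \<open>Since \<open>Rej\<close> is absorbing, an earlier rejection already shortens a prefix.
  Otherwise the last letter is the rejected one, and the shuffled syllable together with it is
  replaced by a shorter word.\<close>

lemma rejected_shortens:
  assumes "w \<in> lists S" "foldl (clique_delta E N) (PClique (\<lambda>_. 0)) w = Rej"
  shows "\<exists>w'\<in>lists S. length w' < length w \<and> w' \<approx> w"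
  using assms
proof (induction w rule: rev_induct)
  case (snoc a w)
  have w: "w \<in> lists S" and a: "a \<in> S" using snoc.prems by auto
  have aW: "[a] \<in> W" using a by (intro std_gens_words) simp
  show ?case
  proof (cases "foldl (clique_delta E N) (PClique (\<lambda>_. 0)) w")
    case Rej
    then obtain w' where "w' \<in> lists S" "length w' < length w" "w' \<approx> w"
      using snoc.IH w by blast
    then show ?thesis
      using a eqv_append_right[OF _ aW] by (intro bexI[of _ "w' @ [a]"]) auto
  next
    case (PClique \<Sigma>)
    define v where "v = letter_base a"
    have v: "v \<in> V" using a by (simp add: v_def std_gens_base)
    obtain w' where w': "w' \<in> lists S" "w \<approx> w' @ syllable v (\<Sigma> v)"
      "length w' + nat \<bar>\<Sigma> v\<bar> = length w"
      using accepted_split_syllable[OF w PClique v] by blast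
    obtain s where s: "s \<in> lists S" "s \<approx> syllable v (\<Sigma> v) @ [a]"
      "length s < Suc (nat \<bar>\<Sigma> v\<bar>)"
      using reject_step_shortens[OF accepted_powered_clique[OF w PClique] a] PClique snoc.prems(2)
      by (auto simp: v_def)
    have "w' @ s \<approx> w' @ syllable v (\<Sigma> v) @ [a]"
      using s(2) w'(1) by (intro eqv_append_left std_gens_words)
    also have "\<dots> = (w' @ syllable v (\<Sigma> v)) @ [a]" by simp
    also have "\<dots> \<approx> w @ [a]"
      by (rule eqv_append_right[OF pres_eq.sym[OF w'(2)] aW])
    finally show ?thesis
      using w' s by (intro bexI[of _ "w' @ s"]) auto
  qed
qed simp

section \<open>Hyperplane crossings\<close>

definition star :: "'a \<Rightarrow> 'a set" where
  "star v = insert v (Lk E v)"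

text \<open>The left coset of the subgroup generated by \<open>star v\<close>, encoded as the set of
  all words representing its elements, so that equality of cosets is equality of sets.\<close>

definition star_coset :: "'a letter list \<Rightarrow> 'a \<Rightarrow> 'a letter list set" where
  "star_coset p v = {q. \<exists>x\<in>group_words (star v). p @ x \<approx> q}"

lemma star_subset: "v \<in> V \<Longrightarrow> star v \<subseteq> V"
  using edge_in by (auto simp: star_def Lk_def)

lemma self_in_star_coset: "p \<in> W \<Longrightarrow> p \<in> star_coset p v"
  unfolding star_coset_def by (auto intro!: bexI[of _ "[]"] pres_eq.refl)

lemma star_coset_eqv:
  assumes "p \<approx> p'" "v \<in> V"
  shows "star_coset p v = star_coset p' v"
proof -
  have "star_coset q v \<subseteq> star_coset q' v" if "q \<approx> q'" for q q'
  proof -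
    have "q' @ x \<approx> r" if "x \<in> group_words (star v)" "q @ x \<approx> r" for x r
      using that \<open>q \<approx> q'\<close> group_words_mono[OF star_subset[OF assms(2)]]
      by (blast intro: pres_eq.trans[OF eqv_append_right[OF pres_eq.sym]])
    then show ?thesis by (auto simp: star_coset_def)
  qed
  then show ?thesis using assms(1) pres_eq.sym by blast
qed

text \<open>Absorbing \<open>z\<close> into the subgroup element gives one inclusion for arbitrary
  \<open>q\<close>; the other is the same inclusion applied to \<open>p @ y\<close> and the inverse
  of \<open>y\<close>.\<close>

lemma star_coset_append:
  assumes "p \<in> W" "y \<in> group_words (star v)" "v \<in> V"
  shows "star_coset (p @ y) v = star_coset p v"
proof -
  have "star_coset (q @ z) v \<subseteq> star_coset q v" if "z \<in> group_words (star v)" for q z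
    using that by (force simp: star_coset_def intro!: bexI[of _ "z @ _"])
  moreover have "star_coset p v \<subseteq> star_coset (p @ y) v"
  proof -
    let ?y = "rev (map formal_inverse y)"
    have "y \<in> W" using assms group_words_mono[OF star_subset] by blast
    then have "p @ (y @ ?y) \<approx> p @ []"
      by (rule eqv_append_left[OF eqv_inverse_right assms(1)])
    then have "star_coset p v = star_coset ((p @ y) @ ?y) v"
      using star_coset_eqv[OF _ assms(3)] by simp
    then show ?thesis
      using calculation[OF group_words_inverse[OF assms(2)], of "p @ y"] by simp
  qed
  ultimately show ?thesis using assms(2) by blast
qed

lemma star_coset_snoc:
  assumes "p \<in> W" "letter_base a \<in> star v" "v \<in> V"
  shows "star_coset (p @ [a]) v = star_coset p v"
  using assms by (intro star_coset_append) (auto simp: group_words_iff)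

text \<open>The sign of a letter is kept as the direction of crossing. Taking the coset before the
  letter is harmless for either sign: \<open>v\<close> lies in \<open>star v\<close>, so the coset
  after the letter is the same.\<close>

fun crossings :: "'a letter list \<Rightarrow> 'a letter list \<Rightarrow> ('a \<times> 'a letter list set) letter list" where
  "crossings p [] = []"
| "crossings p (a # w) = map_letter (\<lambda>v. (v, star_coset p v)) a # crossings (p @ [a]) w"

lemma crossings_append [simp]:
  "crossings p (u @ w) = crossings p u @ crossings (p @ u) w"
  by (induction u arbitrary: p) auto

lemma length_crossings [simp]: "length (crossings p w) = length w"
  by (induction w arbitrary: p) auto

lemma crossings_eqv:
  "p \<approx> p' \<Longrightarrow> w \<in> W \<Longrightarrow> crossings p w = crossings p' w"
proof (induction w arbitrary: p p')
  case (Cons a w)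
  have w: "w \<in> W" and a: "[a] \<in> W" and v: "letter_base a \<in> V"
    using Cons.prems(2) by (auto simp: group_words_iff)
  have "crossings (p @ [a]) w = crossings (p' @ [a]) w"
    by (rule Cons.IH[OF eqv_append_right[OF Cons.prems(1) a] w])
  moreover have "star_coset p (letter_base a) = star_coset p' (letter_base a)"
    by (rule star_coset_eqv[OF Cons.prems(1) v])
  ultimately show ?case by (cases a) auto
qed simp

lemma crossings_fst: "fst ` letter_base ` set (crossings p w) = letter_base ` set w"
  by (induction w arbitrary: p) auto

lemma crossings_split:
  assumes "h \<in> letter_base ` set (crossings p w)"
  obtains u b s where "w = u @ b # s" "h = (letter_base b, star_coset (p @ u) (letter_base b))"
  using assms
proof (induction w arbitrary: p thesis)
  case (Cons a w)
  show ?case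
  proof (cases "h \<in> letter_base ` set (crossings (p @ [a]) w)")
    case True
    obtain u b s where "w = u @ b # s"
      "h = (letter_base b, star_coset ((p @ [a]) @ u) (letter_base b))"
      using Cons.IH[OF _ True] by blast
    then show ?thesis by (intro Cons.prems(1)[of "a # u" b s]) auto
  next
    case False
    then show ?thesis using Cons.prems by (intro Cons.prems(1)[of "[]" a w]) auto
  qed
qed simp

lemma crossings_replicate:
  "p \<in> W \<Longrightarrow> v \<in> V \<Longrightarrow>
    crossings p (replicate n (Gen v)) = replicate n (Gen (v, star_coset p v))"
proof (induction n arbitrary: p)
  case (Suc n)
  then show ?case by (simp add: star_coset_snoc star_def)
qed simp

section \<open>Invariance of charges modulo the orders of the generators\<close>

text \<open>Since \<open>p @ l\<close> and \<open>p @ r\<close> represent the same element, the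
  suffix \<open>s\<close> crosses the same hyperplanes after either. Invariance thus has to be
  checked only on the two sides of a relation.\<close>

lemma charge_context:
  assumes "l \<approx> r" "p \<in> W" "s \<in> W"
    and "[charge (crossings p l) h = charge (crossings p r) h] (mod m)"
  shows "[charge (crossings [] (p @ l @ s)) h = charge (crossings [] (p @ r @ s)) h] (mod m)"
proof -
  have "crossings (p @ l) s = crossings (p @ r) s"
    by (rule crossings_eqv[OF eqv_append_left[OF assms(1,2)] assms(3)])
  then show ?thesis using assms(4) by (simp add: cong_add)
qed

text \<open>Cancellation and commutation preserve charges exactly. A power relator of
  \<open>v\<close> crosses a single hyperplane \<open>N v\<close> times, and relators of other
  generators cross none of type \<open>v\<close>.\<close>

lemma charge_invariant:
  assumes "u \<approx> w"
  shows "[charge (crossings [] u) (v, C) = charge (crossings [] w) (v, C)] (mod int (N v))"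
  using assms
proof (induction rule: pres_eq.induct)
  case (refl w)
  show ?case by simp
next
  case (sym u w)
  then show ?case by (simp add: cong_sym)
next
  case (trans u w z)
  then show ?case using cong_trans by blast
next
  case (cancel p a s)
  have W: "p \<in> W" "s \<in> W" and a: "letter_base a \<in> V"
    using cancel by (auto simp: letter_base_in simp del: Un_iff)
  \<comment> \<open>A letter and its inverse therefore cross the same hyperplane in opposite
    directions.\<close>
  have "star_coset (p @ [a]) (letter_base a) = star_coset p (letter_base a)"
    using W a by (intro star_coset_snoc) (auto simp: star_def)
  then have "crossings p [a, formal_inverse a] =
      [map_letter (\<lambda>v. (v, star_coset p v)) a, formal_inverse (map_letter (\<lambda>v. (v, star_coset p v)) a)]"
    by (cases a) auto
  then have "charge (crossings p [a, formal_inverse a]) (v, C) = 0"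
    by (simp add: charge_Cons[of _ "[_]"] charge_formal_inverse)
  moreover have "[a, formal_inverse a] \<approx> []"
    using eqv_inverse_right[of "[a]"] a by (simp add: group_words_iff)
  ultimately show ?case
    using charge_context[of "[a, formal_inverse a]" "[]" p s "(v, C)" "int (N v)"] W by simp
next
  case (relation l r p s)
  have W: "p \<in> W" "s \<in> W" "l \<in> W" "r \<in> W" using relation by auto
  have eqv: "l \<approx> r" using pres_eq.relation[OF relation(1), of "[]" "[]" V] W by simp
  from relation(1) consider
      (power) u where "u \<in> V" "l = replicate (N u) (Gen u)" "r = []"
    | (commute) x y where "{x, y} \<in> E" "l = [Gen x, Gen y]" "r = [Gen y, Gen x]"
    unfolding NGP_relations_def by blast
  then have "[charge (crossings p l) (v, C) = charge (crossings p r) (v, C)] (mod int (N v))"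
  proof cases
    case power
    then show ?thesis
      using W charge_zero[of "(v, C)" "[Gen (u, star_coset p u)]"]
      by (cases "u = v") (auto simp: crossings_replicate charge_replicate cong_0_iff)
  next
    case commute
    note xy = edge_in[OF commute(1)]
    \<comment> \<open>Each of \<open>x\<close> and \<open>y\<close> lies in the star of the other,
      so the swap only permutes the two crossings.\<close>
    have "star_coset (p @ [Gen x]) y = star_coset p y" "star_coset (p @ [Gen y]) x = star_coset p x"
      using xy commute(1) W by (simp_all add: star_coset_snoc star_def Lk_def insert_commute)
    then show ?thesis
      using commute by (simp add: charge_Cons[of _ "[_]"] add.commute)
  qed
  then show ?case by (rule charge_context[OF eqv W(1,2)])
qed

text \<open>A path from \<open>p\<close> to \<open>w\<close> inside the coset uses only letters from
  \<open>star u\<close>, and so crosses no hyperplane of type \<open>v\<close>.\<close>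

lemma charge_star_coset:
  assumes "w \<in> W" "w \<in> star_coset p u" "v \<notin> star u"
  shows "[charge (crossings [] w) (v, C) = charge (crossings [] p) (v, C)] (mod int (N v))"
proof -
  obtain x where x: "x \<in> group_words (star u)" "p @ x \<approx> w"
    using assms(2) by (auto simp: star_coset_def)
  have "v \<notin> fst ` letter_base ` set (crossings p x)"
    using x(1) assms(3) unfolding crossings_fst by (auto simp: group_words_iff)
  then have "charge (crossings p x) (v, C) = 0"
    by (intro charge_zero) (metis fst_conv image_eqI)
  then show ?thesis using charge_invariant[OF pres_eq.sym[OF x(2)], of v C] by simp
qed

section \<open>Accepted words are geodesic\<close>

definition minimal_crossings :: "'a letter list \<Rightarrow> bool" where
  "minimal_crossings w \<longleftrightarrow> (\<forall>v C.
     (count_list (crossings [] w) (Gen (v, C)) = 0 \<or> count_list (crossings [] w) (Inv (v, C)) = 0) \<and>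
     count_list (crossings [] w) (Gen (v, C)) + count_list (crossings [] w) (Inv (v, C)) \<le> N v div 2)"

lemma minimal_crossings_abs_charge:
  assumes "minimal_crossings w"
  shows "\<bar>charge (crossings [] w) h\<bar> = int (count_list (map letter_base (crossings [] w)) h)"
    and "\<bar>charge (crossings [] w) h\<bar> \<le> int (N (fst h) div 2)"
proof -
  obtain v C where h: "h = (v, C)" by (cases h)
  have *: "count_list (crossings [] w) (Gen (v, C)) = 0 \<or> count_list (crossings [] w) (Inv (v, C)) = 0"
    "count_list (crossings [] w) (Gen (v, C)) + count_list (crossings [] w) (Inv (v, C)) \<le> N v div 2"
    using assms unfolding minimal_crossings_def by auto
  show "\<bar>charge (crossings [] w) h\<bar> = int (count_list (map letter_base (crossings [] w)) h)"
    using * unfolding h charge_def count_list_letter_base by auto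
  show "\<bar>charge (crossings [] w) h\<bar> \<le> int (N (fst h) div 2)"
    using * unfolding h charge_def fst_conv by linarith
qed

text \<open>The two claims need each other: the recorded charge turns the transition condition into
  minimality for the hyperplane just crossed, and minimality shows that a power reset to 0 belongs
  to a hyperplane not crossed before.\<close>

lemma accepted_crossings:
  assumes "w \<in> lists S" "foldl (clique_delta E N) (PClique (\<lambda>_. 0)) w = PClique \<Sigma>"
  shows "minimal_crossings w \<and>
    (\<forall>u\<in>V. charge (crossings [] w) (u, star_coset w u) = \<Sigma> u)"
  using assms
proof (induction w arbitrary: \<Sigma> rule: rev_induct)
  case Nil
  then show ?case by (auto simp: minimal_crossings_def)
next
  case (snoc a w)
  have w: "w \<in> lists S" and a: "a \<in> S" using snoc.prems by auto
  have wW: "w \<in> W" and waW: "w @ [a] \<in> W"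
    using std_gens_words[OF w] std_gens_words[OF snoc.prems(1)] by auto
  obtain \<Sigma>0 where \<Sigma>0: "foldl (clique_delta E N) (PClique (\<lambda>_. 0)) w = PClique \<Sigma>0"
    "clique_delta E N (PClique \<Sigma>0) a = PClique \<Sigma>"
    using foldl_snoc_PClique[OF snoc.prems(2)] .
  obtain v k where v: "v = letter_base a" "\<Sigma> = update_clique E v k \<Sigma>0"
    and step: "a = Gen v \<and> k = \<Sigma>0 v + 1 \<and> 0 \<le> \<Sigma>0 v \<and> \<Sigma>0 v < int (N v div 2) \<or>
     a = Inv v \<and> k = \<Sigma>0 v - 1 \<and> \<Sigma>0 v \<le> 0 \<and> - int (N v div 2) < \<Sigma>0 v"
    using clique_delta_PClique[OF \<Sigma>0(2)] .
  have vV: "v \<in> V" using a v(1) std_gens_base by simp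
  have IH: "minimal_crossings w"
    and IH_state: "\<And>u. u \<in> V \<Longrightarrow> charge (crossings [] w) (u, star_coset w u) = \<Sigma>0 u"
    using snoc.IH[OF w \<Sigma>0(1)] by auto
  define H where "H = (v, star_coset w v)"
  define c where "c = crossings [] w"
  have cross: "crossings [] (w @ [a]) = c @ [map_letter (\<lambda>_. H) a]"
    using v(1) by (cases a) (auto simp: c_def H_def)
  have H: "int (count_list c (Gen H)) - int (count_list c (Inv H)) = \<Sigma>0 v"
    using IH_state[OF vV] by (simp add: charge_def c_def H_def)
  have min: "count_list c (Gen h) = 0 \<or> count_list c (Inv h) = 0"
    "count_list c (Gen h) + count_list c (Inv h) \<le> N (fst h) div 2" for h
    using IH unfolding minimal_crossings_def c_def by (cases h; simp)+
  \<comment> \<open>The two counts differ by \<open>\<Sigma>0 v\<close> and one of them vanishes, so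
    the sign condition of the transition tells which. The strict bound leaves room for one more
    crossing of \<open>H\<close>.\<close>
  have onesided: "a = Gen v \<and> count_list c (Inv H) = 0 \<and> count_list c (Gen H) < N v div 2 \<or>
      a = Inv v \<and> count_list c (Gen H) = 0 \<and> count_list c (Inv H) < N v div 2"
    using step H min(1)[of H] by linarith
  have "minimal_crossings (w @ [a])"
    unfolding minimal_crossings_def cross
  proof (intro allI)
    fix u C
    show "(count_list (c @ [map_letter (\<lambda>_. H) a]) (Gen (u, C)) = 0 \<or>
         count_list (c @ [map_letter (\<lambda>_. H) a]) (Inv (u, C)) = 0) \<and>
       count_list (c @ [map_letter (\<lambda>_. H) a]) (Gen (u, C)) +
         count_list (c @ [map_letter (\<lambda>_. H) a]) (Inv (u, C)) \<le> N u div 2"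
    proof (cases "(u, C) = H")
      case True
      then have "N u = N v" by (simp add: H_def)
      with True onesided show ?thesis by auto
    next
      case False
      then show ?thesis using min[of "(u, C)"] by (cases a) auto
    qed
  qed
  \<comment> \<open>If \<open>v\<close> is in \<open>star u\<close>, the coset is unchanged, and so
    is the charge unless u = v. Otherwise the state resets \<open>u\<close>, and the adjacent
    hyperplane of type \<open>u\<close> must be shown to be new.\<close>
  moreover have "charge (crossings [] (w @ [a])) (u, star_coset (w @ [a]) u) = \<Sigma> u"
    if u: "u \<in> V" for u
  proof (cases "v \<in> star u")
    case True
    then have coset: "star_coset (w @ [a]) u = star_coset w u"
      using v(1) wW u by (intro star_coset_snoc) auto
    show ?thesis
    proof (cases "u = v")
      case True
      then have "charge (c @ [map_letter (\<lambda>_. H) a]) H = k"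
        using step H by (auto simp: charge_def)
      then show ?thesis using True coset v(2) unfolding cross by (simp add: H_def update_clique_def)
    next
      case False
      then have "u \<in> Lk E v" using \<open>v \<in> star u\<close> Lk_sym by (auto simp: star_def)
      then have "\<Sigma> u = \<Sigma>0 u" using False v(2) by (simp add: update_clique_def)
      moreover have "charge [map_letter (\<lambda>_. H) a] (u, star_coset w u) = 0"
        using False by (intro charge_zero) (simp add: H_def)
      ultimately show ?thesis using IH_state[OF u] unfolding cross by (simp add: coset c_def)
    qed
  next
    case False
    then have uv: "u \<noteq> v" "u \<notin> Lk E v" using Lk_sym by (auto simp: star_def)
    then have "\<Sigma> u = 0" using v(2) by (simp add: update_clique_def)
    moreover have "(u, star_coset (w @ [a]) u) \<notin> letter_base ` set (crossings [] (w @ [a]))"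
    proof
      txt \<open>Otherwise \<open>w @ [a]\<close> and an earlier prefix \<open>p\<close> lie in the same coset of
        \<open>\<langle>star u\<rangle>\<close>, so they cross \<open>H\<close> equally often modulo \<open>N v\<close>. But \<open>w @ [a]\<close> crosses
        \<open>H\<close> strictly more often than \<open>p\<close>, in the same direction and at most \<open>N v div 2\<close> times.\<close>
      assume "(u, star_coset (w @ [a]) u) \<in> letter_base ` set (crossings [] (w @ [a]))"
      \<comment> \<open>The last letter crosses \<open>H\<close>, whose type \<open>v\<close>
        differs from \<open>u\<close>, so the supposed crossing happened already in
        \<open>w\<close>.\<close>
      then have "(u, star_coset (w @ [a]) u) \<in> letter_base ` set (crossings [] w)"
        using uv(1) unfolding cross by (auto simp: H_def c_def)
      then obtain p b s where p: "w = p @ b # s"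
        "(u, star_coset (w @ [a]) u) = (letter_base b, star_coset ([] @ p) (letter_base b))"
        by (rule crossings_split)
      then have "w @ [a] \<in> star_coset p u"
        using self_in_star_coset[OF waW, of u] by auto
      from charge_star_coset[OF waW this False, of "snd H"]
      have cong: "[charge (c @ [map_letter (\<lambda>_. H) a]) H = charge (crossings [] p) H] (mod int (N v))"
        unfolding cross by (simp add: H_def)
      have "c = crossings [] p @ crossings p (b # s)" by (simp add: c_def p(1))
      then have le: "count_list (crossings [] p) x \<le> count_list c x" for x by simp
      have "\<bar>charge (c @ [map_letter (\<lambda>_. H) a]) H\<bar> \<le> int (N v div 2)"
        using onesided by (auto simp: charge_def)
      from cong_abs_minimal[OF cong this] show False
        using onesided le[of "Gen H"] le[of "Inv H"] by (auto simp: charge_def)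
    qed
    ultimately show ?thesis using charge_zero by metis
  qed
  ultimately show ?case by blast
qed

text \<open>The length of a word is its number of crossings summed over all hyperplanes, and the
  comparison holds for each hyperplane separately: in \<open>w\<close> the count is the least
  absolute value in the residue class shared with \<open>w'\<close>.\<close>

lemma minimal_crossings_length:
  assumes "minimal_crossings w" "w' \<approx> w"
  shows "length w \<le> length w'"
proof -
  let ?c = "map letter_base (crossings [] w)" and ?c' = "map letter_base (crossings [] w')"
  \<comment> \<open>A common finite index set for both words; hyperplanes crossed by only one of
    them contribute 0 to the other sum.\<close>
  let ?H = "set ?c \<union> set ?c'"
  have "count_list ?c h \<le> count_list ?c' h" for h
  proof -
    have "[charge (crossings [] w) h = charge (crossings [] w') h] (mod int (N (fst h)))"
      using charge_invariant[OF pres_eq.sym[OF assms(2)], of "fst h" "snd h"] by simp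
    then have "\<bar>charge (crossings [] w) h\<bar> \<le> \<bar>charge (crossings [] w') h\<bar>"
      using minimal_crossings_abs_charge(2)[OF assms(1)] by (rule cong_abs_minimal)
    then show ?thesis
      using minimal_crossings_abs_charge(1)[OF assms(1), of h]
        abs_charge_le_count[of "crossings [] w'" h] by linarith
  qed
  then have "sum (count_list ?c) ?H \<le> sum (count_list ?c') ?H"
    by (intro sum_mono)
  moreover have "sum (count_list ?c) ?H = length ?c" "sum (count_list ?c') ?H = length ?c'"
    by (intro sum_count_set; simp)+
  ultimately show ?thesis by simp
qed

lemma language_eq_geodesics:
  "fsa_language (clique_fsa V E N) = geodesic_words (NGP V E N) (NGP_gen V E N) S"
proof (intro equalityI subsetI)
  fix w
  assume "w \<in> fsa_language (clique_fsa V E N)"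
  then obtain \<Sigma> where w: "w \<in> lists S"
    and "foldl (clique_delta E N) (PClique (\<lambda>_. 0)) w = PClique \<Sigma>"
    by (auto simp: fsa_language_def clique_fsa_def)
  then have "minimal_crossings w" using accepted_crossings by blast
  then show "w \<in> geodesic_words (NGP V E N) (NGP_gen V E N) S"
    using w minimal_crossings_length unfolding geodesic_iff by (meson leD)
next
  fix w
  assume "w \<in> geodesic_words (NGP V E N) (NGP_gen V E N) S"
  then have w: "w \<in> lists S" and "\<not> (\<exists>w'\<in>lists S. length w' < length w \<and> w' \<approx> w)"
    unfolding geodesic_iff by blast+
  then have "foldl (clique_delta E N) (PClique (\<lambda>_. 0)) w \<noteq> Rej"
    using rejected_shortens by blast
  then obtain \<Sigma> where "foldl (clique_delta E N) (PClique (\<lambda>_. 0)) w = PClique \<Sigma>"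
    by (cases "foldl (clique_delta E N) (PClique (\<lambda>_. 0)) w") auto
  moreover from this have "powered_clique V E N \<Sigma>" by (rule accepted_powered_clique[OF w])
  ultimately show "w \<in> fsa_language (clique_fsa V E N)"
    using w by (simp add: fsa_language_def clique_fsa_def)
qed

end

theorem theorem4p9:
  fixes V :: "'a set" and E :: "'a set set" and N :: "'a \<Rightarrow> nat"
  assumes "numbered_graph V E N"
  shows "fsa_language (clique_fsa V E N)
    = geodesic_words (NGP V E N) (NGP_gen V E N) (std_gens V N)"
  using numbered.language_eq_geodesics[OF numbered.intro[OF assms]] .

end
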